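(* In the graceful game, Bob has a winning strategy on the wheels $W_3$, $W_4$ and $W_5$ even when Alice is the first player.
   Context: The wheel $W_n$ ($n\geq 3$) is obtained from the cycle $(v_0,\dots,v_{n-1})$ by adding a central vertex $v_n$ adjacent to all $v_0,\dots,v_{n-1}$; it has $n+1$ vertices and $2n$ edges. A graceful labeling of a graph $G$ with $m$ edges is an injective map $f\colon V(G)\to\{0,1,\dots,m\}$ such that the induced edge labels $|f(u)-f(v)|$, $uv\in E(G)$, are pairwise distinct. The graceful game on a simple graph $G$ with $m$ edges: two players, Alice and Bob, alternately choose a free (not yet labeled) vertex and assign to it a label from $\{0,1,\dots,m\}$ not yet used. An edge both of whose endpoints are labeled gets label $|f(u)-f(v)|$; a move is legal only if after it all edge labels are pairwise distinct. Alice wins if the whole graph ends up gracefully labeled; Bob wins if he can prevent this. *)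

theory Defs
  imports Main
begin

record 'a ugraph =
  verts :: "'a set"
  edges :: "'a set set"

definition simple_graph :: "'a ugraph \<Rightarrow> bool" where
  "simple_graph G \<longleftrightarrow> finite (verts G) \<and> (\<forall>e\<in>edges G. e \<subseteq> verts G \<and> card e = 2)"

text \<open>The rim vertices of \<open>wheel n\<close> are \<open>0, \<dots>, n - 1\<close>, and \<open>n\<close> is the hub.\<close>

definition wheel :: "nat \<Rightarrow> nat ugraph" where
  "wheel n = \<lparr>verts = {0..n},
              edges = {{i, (i + 1) mod n} |i. i < n} \<union> {{i, n} |i. i < n}\<rparr>"

lemma simple_graph_wheel:
  assumes "n \<ge> 3"
  shows "simple_graph (wheel n)"
proof -
  have "e \<subseteq> {0..n} \<and> card e = 2" if e: "e \<in> edges (wheel n)" for e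
  proof -
    from e obtain i where i: "i < n" and "e = {i, (i + 1) mod n} \<or> e = {i, n}"
      unfolding wheel_def by auto
    moreover have "(i + 1) mod n \<noteq> i" "(i + 1) mod n \<le> n"
      using i assms by (cases "i + 1 = n"; simp)+
    ultimately obtain j where "e = {i, j}" "j \<le> n" "i \<noteq> j"
      by (metis le_refl nat_neq_iff)
    then show ?thesis using i by simp
  qed
  then show ?thesis
    by (simp add: simple_graph_def wheel_def)
qed

lemma card_verts_wheel: "card (verts (wheel n)) = n + 1"
  by (simp add: wheel_def)

lemma card_edges_wheel:
  assumes "n \<ge> 3"
  shows "card (edges (wheel n)) = 2 * n"
proof -
  let ?rim = "\<lambda>i. {i, (i + 1) mod n}" and ?spoke = "\<lambda>i. {i, n}"
  have eq: "edges (wheel n) = ?rim ` {..<n} \<union> ?spoke ` {..<n}"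
    unfolding wheel_def by auto
  have succ: "(i + 1) mod n = (if i + 1 = n then 0 else i + 1)" if "i < n" for i
    using that by simp
  have "inj_on ?rim {..<n}"
  proof (rule inj_onI)
    fix i j assume ij: "i \<in> {..<n}" "j \<in> {..<n}" "?rim i = ?rim j"
    then consider "i = j" | "i = (j + 1) mod n" "(i + 1) mod n = j"
      unfolding doubleton_eq_iff by blast
    then show "i = j"
    proof cases
      case 2
      have "j + 1 = n \<and> i = 0 \<or> i = j + 1" "i + 1 = n \<and> j = 0 \<or> j = i + 1"
        using 2 succ[of i] succ[of j] ij(1,2) by (metis lessThan_iff)+
      then show ?thesis
        using assms by linarith
    qed
  qed
  moreover have "inj_on ?spoke {..<n}"
    by (rule inj_onI) (auto simp: doubleton_eq_iff)
  moreover have "?rim ` {..<n} \<inter> ?spoke ` {..<n} = {}"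
  proof -
    have "?rim i \<noteq> ?spoke j" if "i < n" for i j
      using that assms mod_less_divisor[of n "i + 1"]
      unfolding doubleton_eq_iff by linarith
    then show ?thesis by blast
  qed
  ultimately show ?thesis
    unfolding eq by (subst card_Un_disjoint) (simp_all add: card_image del: One_nat_def)
qed

definition graceful_labeling :: "'a ugraph \<Rightarrow> ('a \<Rightarrow> nat) \<Rightarrow> bool" where
  "graceful_labeling G f \<longleftrightarrow>
     inj_on f (verts G) \<and>
     f ` verts G \<subseteq> {0..card (edges G)} \<and>
     (\<forall>u v x y. {u, v} \<in> edges G \<longrightarrow> {x, y} \<in> edges G \<longrightarrow>
        \<bar>int (f u) - int (f v)\<bar> = \<bar>int (f x) - int (f y)\<bar> \<longrightarrow> {u, v} = {x, y})"

definition distinct_edge_labels :: "'a ugraph \<Rightarrow> ('a \<rightharpoonup> nat) \<Rightarrow> bool" where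
  "distinct_edge_labels G p \<longleftrightarrow>
     (\<forall>u v x y a b c d. {u, v} \<in> edges G \<longrightarrow> {x, y} \<in> edges G \<longrightarrow>
        p u = Some a \<longrightarrow> p v = Some b \<longrightarrow> p x = Some c \<longrightarrow> p y = Some d \<longrightarrow>
        \<bar>int a - int b\<bar> = \<bar>int c - int d\<bar> \<longrightarrow> {u, v} = {x, y})"

type_synonym 'a move = "'a \<times> nat"

definition legal_move :: "'a ugraph \<Rightarrow> ('a \<rightharpoonup> nat) \<Rightarrow> 'a move \<Rightarrow> bool" where
  "legal_move G p = (\<lambda>(v, l).
     v \<in> verts G \<and> p v = None \<and> l \<in> {0..card (edges G)} \<and> l \<notin> ran p \<and>
     distinct_edge_labels G (p(v \<mapsto> l)))"

text \<open>
  A play is the chronological list of the moves made so far. No vertex is labeled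
  twice in a legal play, so \<open>map_of\<close> yields the current partial labeling.
\<close>

type_synonym 'a play = "'a move list"

definition legal_play :: "'a ugraph \<Rightarrow> 'a play \<Rightarrow> bool" where
  "legal_play G h \<longleftrightarrow> (\<forall>i<length h. legal_move G (map_of (take i h)) (h ! i))"

text \<open>
  A play ends when the player to move has no legal move; this includes the case
  that all vertices are labeled.
\<close>

definition finished_play :: "'a ugraph \<Rightarrow> 'a play \<Rightarrow> bool" where
  "finished_play G h \<longleftrightarrow> legal_play G h \<and> (\<nexists>mv. legal_move G (map_of h) mv)"

definition alice_wins_play :: "'a ugraph \<Rightarrow> 'a play \<Rightarrow> bool" where
  "alice_wins_play G h \<longleftrightarrow>
     finished_play G h \<and> dom (map_of h) = verts G \<and>
     graceful_labeling G (\<lambda>v. the (map_of h v))"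

definition bob_wins_play :: "'a ugraph \<Rightarrow> 'a play \<Rightarrow> bool" where
  "bob_wins_play G h \<longleftrightarrow> finished_play G h \<and> \<not> alice_wins_play G h"

datatype player = Alice | Bob

fun opponent :: "player \<Rightarrow> player" where
  "opponent Alice = Bob"
| "opponent Bob = Alice"

definition to_move :: "player \<Rightarrow> 'a play \<Rightarrow> player" where
  "to_move first h = (if even (length h) then first else opponent first)"

type_synonym 'a strategy = "'a play \<Rightarrow> 'a move"

definition bob_follows :: "player \<Rightarrow> 'a strategy \<Rightarrow> 'a play \<Rightarrow> bool" where
  "bob_follows first s h \<longleftrightarrow>
     (\<forall>i<length h. to_move first (take i h) = Bob \<longrightarrow> h ! i = s (take i h))"

text \<open>
  The first conjunct makes \<open>s\<close> answer with a legal move whenever Bob has one;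
  without it, a strategy could win vacuously by proposing illegal moves.
\<close>

definition bob_winning_strategy :: "'a ugraph \<Rightarrow> player \<Rightarrow> 'a strategy \<Rightarrow> bool" where
  "bob_winning_strategy G first s \<longleftrightarrow>
     (\<forall>h. legal_play G h \<and> bob_follows first s h \<and> to_move first h = Bob \<and>
          (\<exists>mv. legal_move G (map_of h) mv) \<longrightarrow> legal_move G (map_of h) (s h)) \<and>
     (\<forall>h. finished_play G h \<and> bob_follows first s h \<longrightarrow> bob_wins_play G h)"

definition bob_has_winning_strategy :: "'a ugraph \<Rightarrow> player \<Rightarrow> bool" where
  "bob_has_winning_strategy G first \<longleftrightarrow> (\<exists>s. bob_winning_strategy G first s)"

end

theory Submission
  imports Defs
begin

text \<open>
  Bob ruins the game with his very first move: he always reaches a position that no graceful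
  labeling extends, and from then on it does not matter who plays what. No graceful labeling of
  \<open>W\<^sub>n\<close>, \<open>n \<in> {3, 4, 5}\<close>, has label \<open>n\<close> on the hub, so Bob plays that if he can. If Alice has
  already put \<open>n\<close> on the rim, the hub label \<open>n - 1\<close> is fatal, and if she has labeled the hub,
  then \<open>n\<close> on the rim is fatal, except that in \<open>W\<^sub>4\<close> with hub label \<open>1\<close> or \<open>7\<close> Bob needs \<open>3\<close>
  instead. That these positions are fatal is checked by exhaustive search.
\<close>

section \<open>Fatal positions\<close>

text \<open>Only complete labelings enter, so fatality depends neither on whose turn it is nor on
  how the position arose.\<close>

definition fatal :: "'a ugraph \<Rightarrow> ('a \<rightharpoonup> nat) \<Rightarrow> bool" where
  "fatal G p \<longleftrightarrow> (\<nexists>f. graceful_labeling G f \<and> (\<forall>v l. p v = Some l \<longrightarrow> f v = l))"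

lemma fatal_mono: "fatal G p \<Longrightarrow> p \<subseteq>\<^sub>m q \<Longrightarrow> fatal G q"
  unfolding fatal_def map_le_def by (metis domI)

text \<open>In \<open>map_of\<close> the earlier entries prevail, so every play extends the position
  of its prefix, and a win for Alice would be a graceful extension of it.\<close>

lemma alice_loses_if_fatal:
  assumes "fatal G (map_of (take k h))"
  shows "\<not> alice_wins_play G h"
proof -
  have "map_of (take k h) \<subseteq>\<^sub>m map_of h"
    by (metis append_take_drop_id map_le_map_add map_of_append)
  then have "fatal G (map_of h)"
    using assms fatal_mono by blast
  then show ?thesis
    unfolding fatal_def alice_wins_play_def by (metis option.sel)
qed

lemma bob_wins_by_fatal_first_move:
  assumes "\<exists>mv. legal_move G Map.empty mv"
    and fatal_move: "\<And>h. \<lbrakk>legal_play G h; to_move first h = Bob; length h \<le> 1\<rbrakk> \<Longrightarrow>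
      \<exists>mv. legal_move G (map_of h) mv \<and> fatal G (map_of (h @ [mv]))"
  shows "bob_has_winning_strategy G first"
proof -
  let ?P = "\<lambda>h mv. legal_move G (map_of h) mv \<and> fatal G (map_of (h @ [mv]))"
  \<comment> \<open>A fatal move is taken whenever one exists; otherwise any legal move is, since
    the strategy must stay legal to the end of the play.\<close>
  define s where
    "s h = (if \<exists>mv. ?P h mv then SOME mv. ?P h mv else SOME mv. legal_move G (map_of h) mv)" for h
  have s_fatal: "?P h (s h)" if "\<exists>mv. ?P h mv" for h
    using someI_ex[OF that] that by (simp add: s_def)
  have s_legal: "legal_move G (map_of h) (s h)" if "\<exists>mv. legal_move G (map_of h) mv" for h
  proof (cases "\<exists>mv. ?P h mv")
    case True
    then show ?thesis using s_fatal by blast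
  next
    case False
    then show ?thesis using someI_ex[OF that] unfolding s_def by (simp only: if_False)
  qed
  have "bob_wins_play G h" if fin: "finished_play G h" and fol: "bob_follows first s h" for h
  proof -
    \<comment> \<open>The index of Bob's first move. A play too short to contain it cannot be
      finished, because a legal move still exists.\<close>
    define k :: nat where "k = (if first = Bob then 0 else 1)"
    have "k < length h"
    proof (rule ccontr)
      assume "\<not> k < length h"
      then consider "h = []" | "length h = 1" "first = Alice"
        by (cases first) (auto simp: k_def le_Suc_eq not_less split: if_splits)
      then show False
      proof cases
        case 1
        then show ?thesis
          using fin assms(1) by (simp add: finished_play_def)
      next
        case 2
        then show ?thesis
          using fin fatal_move[of h] by (auto simp: finished_play_def to_move_def)
      qed
    qed
    moreover have bob: "to_move first (take k h) = Bob"
      using \<open>k < length h\<close> by (cases first) (auto simp: to_move_def k_def)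
    ultimately have "h ! k = s (take k h)"
      using fol by (simp add: bob_follows_def)
    moreover have "legal_play G (take k h)"
      using fin \<open>k < length h\<close> by (simp add: finished_play_def legal_play_def)
    then have "?P (take k h) (s (take k h))"
      by (intro s_fatal fatal_move bob) (auto simp: k_def)
    ultimately have "fatal G (map_of (take (Suc k) h))"
      using \<open>k < length h\<close> by (simp add: take_Suc_conv_app_nth)
    then show ?thesis
      using alice_loses_if_fatal fin by (simp add: bob_wins_play_def)
  qed
  then have "bob_winning_strategy G first s"
    using s_legal by (auto simp: bob_winning_strategy_def)
  then show ?thesis
    by (auto simp: bob_has_winning_strategy_def)
qed

section \<open>Legality of the first two moves\<close>

text \<open>At most one edge has both endpoints labeled, so no two edge labels can clash. The case
  \<open>u = w\<close> serves the first move.\<close>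

lemma distinct_edge_labels_if_two_labeled:
  assumes "simple_graph G" "dom p \<subseteq> {u, w}"
  shows "distinct_edge_labels G p"
proof -
  have "{x, y} = {u, w}" if "{x, y} \<in> edges G" "p x = Some a" "p y = Some b" for x y a b
  proof -
    have "x \<noteq> y" using that(1) assms(1) by (auto simp: simple_graph_def)
    moreover have "x \<in> {u, w}" "y \<in> {u, w}" using that(2,3) assms(2) by blast+
    ultimately show ?thesis by auto
  qed
  then show ?thesis
    unfolding distinct_edge_labels_def by metis
qed

lemma legal_move_wheel_first:
  assumes "n \<ge> 3" "v \<le> n" "l \<le> 2 * n"
  shows "legal_move (wheel n) Map.empty (v, l)"
  using assms distinct_edge_labels_if_two_labeled[of "wheel n" "[v \<mapsto> l]" v v]
  by (simp add: legal_move_def card_edges_wheel simple_graph_wheel) (simp add: wheel_def)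

lemma legal_move_wheel_second:
  assumes "n \<ge> 3" "w \<le> n" "k \<le> 2 * n" "w \<noteq> v" "k \<noteq> l"
  shows "legal_move (wheel n) [v \<mapsto> l] (w, k)"
  using assms distinct_edge_labels_if_two_labeled[of "wheel n" "[v \<mapsto> l, w \<mapsto> k]" v w]
  by (auto simp: legal_move_def card_edges_wheel simple_graph_wheel) (simp add: wheel_def)

section \<open>Exhaustive search for graceful labelings of wheels\<close>

text \<open>Plain comparisons, suited to evaluation in the search. The pair \<open>n\<close>,
  \<open>n\<close> also satisfies them, so \<open>u \<noteq> w\<close> is demanded separately where
  edges are concluded.\<close>

definition adjacent :: "nat \<Rightarrow> nat \<Rightarrow> nat \<Rightarrow> bool" where
  "adjacent n u w \<longleftrightarrow> u = n \<or> w = n \<or> u = Suc w \<or> w = Suc u \<or>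
     u = 0 \<and> Suc w = n \<or> w = 0 \<and> Suc u = n"

lemma adjacent_imp_edge:
  assumes "adjacent n u w" "u \<le> n" "w \<le> n" "u \<noteq> w"
  shows "{u, w} \<in> edges (wheel n)"
proof -
  have spoke: "{i, n} \<in> edges (wheel n)" and rim: "{i, (i + 1) mod n} \<in> edges (wheel n)"
    if "i < n" for i
    using that by (auto simp: wheel_def)
  have "(i + 1) mod n = (if Suc i = n then 0 else Suc i)" if "i < n" for i
    using that by auto
  with rim have rim': "{i, if Suc i = n then 0 else Suc i} \<in> edges (wheel n)" if "i < n" for i
    using that by metis
  consider "w = n" "u < n" | "u = n" "w < n" | "u < n" "w < n" "u \<noteq> n" "w \<noteq> n"
    using assms by linarith
  then show ?thesis
  proof cases
    case 1
    then show ?thesis using spoke by simp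
  next
    case 2
    then show ?thesis using spoke[of w] by (simp add: insert_commute)
  next
    case 3
    then show ?thesis
      using assms(1) rim'[of u] rim'[of w]
      by (auto simp: adjacent_def insert_commute split: if_splits)
  qed
qed

text \<open>With truncated subtraction, \<open>(l - k) + (k - l)\<close> is the absolute difference.\<close>

fun edge_labels :: "nat \<Rightarrow> nat play \<Rightarrow> nat list" where
  "edge_labels n [] = []"
| "edge_labels n ((v, l) # h) =
     map (\<lambda>(w, k). (l - k) + (k - l)) (filter (\<lambda>(w, k). adjacent n v w) h) @ edge_labels n h"

text \<open>Backtracking search: a branch is abandoned as soon as a vertex label or an edge label
  repeats.\<close>

fun extendable :: "nat \<Rightarrow> nat play \<Rightarrow> nat list \<Rightarrow> bool" where
  "extendable n h [] \<longleftrightarrow> True"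
| "extendable n h (v # vs) \<longleftrightarrow> list_ex (\<lambda>l. l \<notin> snd ` set h \<and>
     distinct (edge_labels n ((v, l) # h)) \<and> extendable n ((v, l) # h) vs) [0..<2 * n + 1]"

section \<open>Soundness of the search\<close>

lemma edge_labels_memberE:
  assumes "d \<in> set (edge_labels n h)" "distinct (map fst h)"
  obtains u k w l where "(u, k) \<in> set h" "(w, l) \<in> set h" "u \<noteq> w" "adjacent n u w"
    "int d = \<bar>int k - int l\<bar>"
  using assms
proof (induction n h arbitrary: thesis rule: edge_labels.induct)
  case (2 n v l h)
  from "2.prems"(2) consider (new) w k where "(w, k) \<in> set h" "adjacent n v w"
      "d = (l - k) + (k - l)" | (old) "d \<in> set (edge_labels n h)"
    by auto
  then show ?case
  proof cases
    case new
    moreover have "v \<noteq> w" using new(1) "2.prems"(3) by force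
    ultimately show ?thesis using "2.prems"(1)[of v l w k] by auto
  next
    case old
    have "distinct (map fst h)" using "2.prems"(3) by simp
    with old show ?thesis
    proof (rule "2.IH"[rotated])
      fix u k w l'
      assume "(u, k) \<in> set h" "(w, l') \<in> set h" "u \<noteq> w" "adjacent n u w"
        "int d = \<bar>int k - int l'\<bar>"
      then show ?thesis using "2.prems"(1)[of u k w l'] by simp
    qed
  qed
qed simp

text \<open>By gracefulness equal labels come from equal edges. Edges from the newest vertex
  \<open>v\<close> to older ones differ in their other endpoint, and no edge among the older
  vertices contains \<open>v\<close>.\<close>

lemma distinct_edge_labels_graceful:
  assumes "graceful_labeling (wheel n) f" "\<forall>(v, l) \<in> set h. v \<le> n \<and> l = f v"
    and "distinct (map fst h)"
  shows "distinct (edge_labels n h)"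
  using assms(2,3)
proof (induction h)
  case (Cons vl h)
  obtain v where vl: "vl = (v, f v)" "v \<le> n" using Cons.prems by (cases vl) auto
  have edge_eq: "{u, w} = {x, y}"
    if "adjacent n u w" "adjacent n x y" "u \<noteq> w" "x \<noteq> y" "u \<le> n" "w \<le> n" "x \<le> n" "y \<le> n"
      "\<bar>int (f u) - int (f w)\<bar> = \<bar>int (f x) - int (f y)\<bar>" for u w x y
    using assms(1) that adjacent_imp_edge unfolding graceful_labeling_def by metis
  have nbr: "w \<le> n" "k = f w" "w \<noteq> v" if "(w, k) \<in> set h" for w k
    using that Cons.prems vl by force+
  let ?new = "filter (\<lambda>(w, k). adjacent n v w) h"
  let ?d = "\<lambda>(w, k). (f v - k) + (k - f v)"
  have "inj_on ?d (set ?new)"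
  proof (rule inj_onI, clarsimp)
    fix w k x j assume *: "(w, k) \<in> set h" "(x, j) \<in> set h" "adjacent n v w" "adjacent n v x"
      "f v - k + (k - f v) = f v - j + (j - f v)"
    then have "{v, w} = {v, x}"
      using nbr[OF *(1)] nbr[OF *(2)] vl(2) by (intro edge_eq) auto
    then show "w = x \<and> k = j"
      using nbr[OF *(1)] nbr[OF *(2)] by (auto simp: doubleton_eq_iff)
  qed
  moreover have "distinct ?new"
    using Cons.prems(2) by (auto simp: distinct_map)
  ultimately have "distinct (map ?d ?new)"
    by (simp add: distinct_map)
  moreover have "set (map ?d ?new) \<inter> set (edge_labels n h) = {}"
  proof (rule ccontr)
    assume "set (map ?d ?new) \<inter> set (edge_labels n h) \<noteq> {}"
    then obtain d where d: "d \<in> set (map ?d ?new)" and d': "d \<in> set (edge_labels n h)"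
      by blast
    from d obtain w k where w: "(w, k) \<in> set h" "adjacent n v w" "d = (f v - k) + (k - f v)"
      by auto
    have "distinct (map fst h)" using Cons.prems(2) by simp
    with d' obtain x j y i where xy: "(x, j) \<in> set h" "(y, i) \<in> set h" "x \<noteq> y" "adjacent n x y"
      "int d = \<bar>int j - int i\<bar>"
      by (rule edge_labels_memberE)
    have "{v, w} = {x, y}"
      using w xy nbr[OF w(1)] nbr[OF xy(1)] nbr[OF xy(2)] vl(2) by (intro edge_eq) auto
    then show False
      using nbr[OF xy(1)] nbr[OF xy(2)] by (auto simp: doubleton_eq_iff)
  qed
  moreover have "distinct (edge_labels n h)"
    using Cons by simp
  ultimately show ?case
    by (simp add: vl)
qed simp

text \<open>The labeling \<open>f\<close> is itself a surviving branch: at each vertex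
  \<open>v\<close> the candidate \<open>f v\<close> passes all tests.\<close>

lemma extendable_if_graceful:
  assumes "n \<ge> 3" "graceful_labeling (wheel n) f"
    and "\<forall>(v, l) \<in> set h. v \<le> n \<and> l = f v" "distinct (map fst h @ vs)" "set vs \<subseteq> {..n}"
  shows "extendable n h vs"
  using assms(3-)
proof (induction vs arbitrary: h)
  case (Cons v vs)
  have v: "v \<le> n" using Cons.prems by simp
  have "verts (wheel n) = {0..n}" by (simp add: wheel_def)
  then have f: "inj_on f {0..n}" "f ` {0..n} \<subseteq> {0..2 * n}"
    using assms(1,2) by (simp_all add: graceful_labeling_def card_edges_wheel)
  have prems: "\<forall>(w, l) \<in> set ((v, f v) # h). w \<le> n \<and> l = f w"
    "distinct (map fst ((v, f v) # h) @ vs)" "set vs \<subseteq> {..n}"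
    using Cons.prems v by auto
  have "f v \<notin> snd ` set h"
  proof
    assume "f v \<in> snd ` set h"
    then obtain w where w: "(w, f v) \<in> set h" by auto
    then have "w = v"
      using Cons.prems(1) f(1) v by (auto simp: inj_on_def)
    then show False
      using w Cons.prems(2) by force
  qed
  moreover have "distinct (edge_labels n ((v, f v) # h))"
    using prems(2) by (intro distinct_edge_labels_graceful[OF assms(2) prems(1)]) simp
  moreover have "extendable n ((v, f v) # h) vs"
    using Cons.IH[OF prems] .
  moreover have "f v \<in> set [0..<2 * n + 1]"
    using image_subset_iff[THEN iffD1, OF f(2), rule_format, of v] v by simp linarith
  ultimately show ?case
    unfolding extendable.simps list_ex_iff by blast
qed simp

lemma fatal_if_not_extendable:
  assumes "\<not> extendable n h vs" "n \<ge> 3" "distinct (map fst h @ vs)"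
    "set (map fst h @ vs) \<subseteq> {..n}"
  shows "fatal (wheel n) (map_of h)"
  unfolding fatal_def
proof
  assume "\<exists>f. graceful_labeling (wheel n) f \<and> (\<forall>v l. map_of h v = Some l \<longrightarrow> f v = l)"
  then obtain f where f: "graceful_labeling (wheel n) f" "\<forall>v l. map_of h v = Some l \<longrightarrow> f v = l"
    by blast
  have "\<forall>(v, l) \<in> set h. v \<le> n \<and> l = f v"
    using f(2) assms(3,4) by (force simp: map_of_is_SomeI)
  then have "extendable n h vs"
    using assms f(1) by (intro extendable_if_graceful) auto
  then show False
    using assms(1) by blast
qed

section \<open>Bob's replies\<close>

text \<open>Here \<open>h\<close> is the hub label. The exception is forced: in
  \<open>wheel 4\<close> the hub 1 with rim 0, 8, 4, 6 is graceful, and so is its complement with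
  hub 7 and rim 8, 0, 4, 2. Both have 4 on the rim.\<close>

definition bob_rim_label :: "nat \<Rightarrow> nat \<Rightarrow> nat" where
  "bob_rim_label n h = (if n = 4 \<and> (h = 1 \<or> h = 7) then 3 else n)"

lemma search_hub_n:
  "list_all (\<lambda>n. \<not> extendable n [(n, n)] [0..<n]) [3, 4, 5]"
  by code_simp

text \<open>Alice chooses the rim vertex here, so every \<open>v\<close> is searched instead of
  arguing by rotation. When Bob labels the rim he picks vertex 0, and one position suffices.\<close>

lemma search_rim_n:
  "list_all (\<lambda>n. list_all (\<lambda>v. \<not> extendable n [(v, n), (n, n - 1)] (remove1 v [0..<n])) [0..<n])
     [3, 4, 5]"
  by code_simp

lemma search_hub_other:
  "list_all (\<lambda>n. list_all (\<lambda>l. l = n \<or> \<not> extendable n [(n, l), (0, bob_rim_label n l)] [1..<n])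
     [0..<2 * n + 1]) [3, 4, 5]"
  by code_simp

context
  fixes n :: nat
  assumes n: "n \<in> {3, 4, 5}"
begin

lemma n': "n \<in> set [3, 4, 5]"
  using n by simp

lemma fatal_hub_n: "fatal (wheel n) [n \<mapsto> n]"
proof -
  have "\<not> extendable n [(n, n)] [0..<n]"
    using search_hub_n n' unfolding list_all_iff by blast
  then have "fatal (wheel n) (map_of [(n, n)])"
    by (rule fatal_if_not_extendable) (use n in auto)
  then show ?thesis by simp
qed

lemma fatal_rim_n:
  assumes "v < n"
  shows "fatal (wheel n) (map_of [(v, n), (n, n - 1)])"
proof (rule fatal_if_not_extendable)
  have "v \<in> set [0..<n]" using assms by simp
  then show "\<not> extendable n [(v, n), (n, n - 1)] (remove1 v [0..<n])"
    using search_rim_n n' unfolding list_all_iff by blast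
qed (use n assms in auto)

lemma fatal_hub_other:
  assumes "l \<le> 2 * n" "l \<noteq> n"
  shows "fatal (wheel n) (map_of [(n, l), (0, bob_rim_label n l)])"
proof (rule fatal_if_not_extendable)
  have "l \<in> set [0..<2 * n + 1]" using assms by auto
  then show "\<not> extendable n [(n, l), (0, bob_rim_label n l)] [1..<n]"
    using search_hub_other n' assms(2) unfolding list_all_iff by blast
qed (use n in auto)

lemma bob_fatal_reply:
  assumes v: "v \<le> n" and l: "l \<le> 2 * n"
  shows "\<exists>mv. legal_move (wheel n) [v \<mapsto> l] mv \<and> fatal (wheel n) (map_of [(v, l), mv])"
proof -
  have n3: "n \<ge> 3" using n by auto
  consider (rim) "v < n" "l \<noteq> n" | (rim_n) "v < n" "l = n" | (hub) "v = n" "l \<noteq> n"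
    | (hub_n) "v = n" "l = n"
    using v by linarith
  then show ?thesis
  proof cases
    case rim
    then have "fatal (wheel n) (map_of [(v, l), (n, n)])"
      by (intro fatal_mono[OF fatal_hub_n]) (auto simp: map_le_def)
    moreover have "legal_move (wheel n) [v \<mapsto> l] (n, n)"
      using rim n3 by (intro legal_move_wheel_second) auto
    ultimately show ?thesis by blast
  next
    case rim_n
    then have "legal_move (wheel n) [v \<mapsto> l] (n, n - 1)"
      using n3 by (intro legal_move_wheel_second) auto
    then show ?thesis
      using fatal_rim_n rim_n by blast
  next
    case hub
    then have "legal_move (wheel n) [v \<mapsto> l] (0, bob_rim_label n l)"
      using n3 by (intro legal_move_wheel_second) (auto simp: bob_rim_label_def)
    then show ?thesis
      using fatal_hub_other hub l by blast
  next
    case hub_n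
    \<comment> \<open>Alice's own move is already fatal, so Bob may answer with any legal
      move.\<close>
    then have "fatal (wheel n) (map_of [(v, l), (0, 0)])"
      by (intro fatal_mono[OF fatal_hub_n]) (auto simp: map_le_def)
    moreover have "legal_move (wheel n) [v \<mapsto> l] (0, 0)"
      using hub_n n3 by (intro legal_move_wheel_second) auto
    ultimately show ?thesis by blast
  qed
qed

end

theorem theorem7:
  fixes n :: nat and first :: player
  assumes "n \<in> {3, 4, 5}"
  shows "bob_has_winning_strategy (wheel n) first"
proof (rule bob_wins_by_fatal_first_move)
  have n3: "n \<ge> 3" using assms by auto
  have hub: "legal_move (wheel n) Map.empty (n, n)"
    using n3 by (intro legal_move_wheel_first) auto
  then show "\<exists>mv. legal_move (wheel n) Map.empty mv" by blast
  fix h assume legal: "legal_play (wheel n) h" and "length h \<le> 1"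
  then consider "h = []" | v l where "h = [(v, l)]"
    by (cases h) auto
  then show "\<exists>mv. legal_move (wheel n) (map_of h) mv \<and> fatal (wheel n) (map_of (h @ [mv]))"
  proof cases
    \<comment> \<open>Bob begins and puts the label \<open>n\<close> on the hub at once.\<close>
    case 1
    then show ?thesis
      using hub fatal_hub_n[OF assms] by auto
  next
    case 2
    then have "v \<le> n" "l \<le> 2 * n"
      using legal n3 by (auto simp: legal_play_def legal_move_def card_edges_wheel)
        (auto simp: wheel_def)
    then show ?thesis
      using bob_fatal_reply[OF assms] 2 by simp
  qed
qed

end
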